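(* Let $0<\lambda<1$, $1<p<\infty$ and $\theta=1-\frac{1-\lambda}{p}$. In general, the trace target $(X_0,X_1)_{\theta,\infty}$ of the Morrey evolution class cannot be replaced by $(X_0,X_1)_{\theta,q}$ for any finite $q$: for every $1\le q<\infty$ there exist a Banach couple $(X_0,X_1)$ with continuous embedding $X_1\hookrightarrow X_0$, a $T\in(0,\infty)$, and a function $u\in\mathbb E^{p,\lambda}(0,T;X_0,X_1)$ such that $u(0)\notin(X_0,X_1)_{\theta,q}$.
   Context: For a Banach space $X$, the time-Morrey space $\mathcal M^{p,\lambda}(0,T;X)$ consists of the (strongly measurable) functions $f:(0,T)\to X$ with finite norm $$\|f\|_{\mathcal M^{p,\lambda}(0,T;X)}:=\sup_{I\subset(0,T)}|I|^{-\lambda/p}\Bigl(\int_I\|f(t)\|_X^p\,dt\Bigr)^{1/p},$$ the supremum being over all intervals $I\subset(0,T)$. The Morrey evolution class is $\mathbb E^{p,\lambda}(0,T;X_0,X_1):=\{u: u\in\mathcal M^{p,\lambda}(0,T;X_1),\ \partial_t u\in\mathcal M^{p,\lambda}(0,T;X_0)\}$, with $\partial_t u$ understood in the sense of $X_0$-valued distributions. Every $u$ in this class has an absolutely continuous $X_0$-valued representative on $[0,T]$, and $u(0)$ denotes the value of this representative at $0$; one always has $u(0)\in(X_0,X_1)_{\theta,\infty}$. A Banach couple is a pair of Banach spaces continuously embedded in a common Hausdorff topological vector space. For $x\in X_0+X_1$ and $r>0$, $$K(r,x;X_0,X_1):=\inf\{\|x_0\|_{X_0}+r\|x_1\|_{X_1}: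 x=x_0+x_1,\ x_0\in X_0,\ x_1\in X_1\}.$$ For $0<\theta<1$, $(X_0,X_1)_{\theta,q}$ is the set of $x\in X_0+X_1$ for which $\bigl(\int_0^\infty(r^{-\theta}K(r,x;X_0,X_1))^q\,\frac{dr}{r}\bigr)^{1/q}$ is finite if $1\le q<\infty$, and $\sup_{r>0}r^{-\theta}K(r,x;X_0,X_1)$ is finite if $q=\infty$. *)

theory Defs
  imports "HOL-Analysis.Analysis"
begin

section \<open>Banach spaces as closed subspaces, and Banach couples\<close>

text \<open>HOL cannot quantify existentially over types. So that one can say "there exist Banach
  spaces", a Banach space is rendered as a closed linear subspace (with the inherited norm) of a
  Banach space type. In the type of bounded continuous functions on the real line below, every
  separable real Banach space occurs, up to isometric isomorphism, as such a subspace: by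
  Banach--Mazur it embeds into \<open>C[0,1]\<close>, whose elements extend by constants to the line.\<close>

instance bcontfun :: (metric_space, banach) banach ..

type_synonym cbdd = "real \<Rightarrow>\<^sub>C real"

definition banach_subspace :: "'a::banach set \<Rightarrow> bool" where
  "banach_subspace X \<longleftrightarrow> subspace X \<and> closed X"

text \<open>The carrier of the topology \<open>V\<close> is a linear subspace, not necessarily the whole type.\<close>

definition hausdorff_tvs :: "'v::real_vector topology \<Rightarrow> bool" where
  "hausdorff_tvs V \<longleftrightarrow>
     subspace (topspace V) \<and> Hausdorff_space V \<and>
     continuous_map (prod_topology V V) V (\<lambda>(x, y). x + y) \<and>
     continuous_map (prod_topology euclideanreal V) V (\<lambda>(c, x). c *\<^sub>R x)"

definition continuous_embedding ::
  "'a::banach set \<Rightarrow> 'v::real_vector topology \<Rightarrow> ('a \<Rightarrow> 'v) \<Rightarrow> bool" where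
  "continuous_embedding X V j \<longleftrightarrow>
     (\<forall>x\<in>X. \<forall>y\<in>X. j (x + y) = j x + j y) \<and>
     (\<forall>c. \<forall>x\<in>X. j (c *\<^sub>R x) = c *\<^sub>R j x) \<and>
     inj_on j X \<and> continuous_map (top_of_set X) V j"

definition banach_couple ::
  "'v::real_vector topology \<Rightarrow> 'a::banach set \<Rightarrow> ('a \<Rightarrow> 'v) \<Rightarrow> 'b::banach set \<Rightarrow> ('b \<Rightarrow> 'v) \<Rightarrow> bool" where
  "banach_couple V X0 j0 X1 j1 \<longleftrightarrow>
     hausdorff_tvs V \<and> banach_subspace X0 \<and> banach_subspace X1 \<and>
     continuous_embedding X0 V j0 \<and> continuous_embedding X1 V j1"

section \<open>Real interpolation\<close>

definition ennpowr :: "ennreal \<Rightarrow> real \<Rightarrow> ennreal" where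
  "ennpowr x a = (if x = \<infinity> then \<infinity> else ennreal (enn2real x powr a))"

definition couple_sum ::
  "'a::banach set \<Rightarrow> ('a \<Rightarrow> 'v::real_vector) \<Rightarrow> 'b::banach set \<Rightarrow> ('b \<Rightarrow> 'v) \<Rightarrow> 'v set" where
  "couple_sum X0 j0 X1 j1 = {j0 x0 + j1 x1 | x0 x1. x0 \<in> X0 \<and> x1 \<in> X1}"

definition K_functional ::
  "'a::banach set \<Rightarrow> ('a \<Rightarrow> 'v::real_vector) \<Rightarrow> 'b::banach set \<Rightarrow> ('b \<Rightarrow> 'v) \<Rightarrow> real \<Rightarrow> 'v \<Rightarrow> real" where
  "K_functional X0 j0 X1 j1 r x =
     Inf {norm x0 + r * norm x1 | x0 x1. x0 \<in> X0 \<and> x1 \<in> X1 \<and> x = j0 x0 + j1 x1}"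

definition real_interp ::
  "real \<Rightarrow> real \<Rightarrow> 'a::banach set \<Rightarrow> ('a \<Rightarrow> 'v::real_vector) \<Rightarrow> 'b::banach set \<Rightarrow> ('b \<Rightarrow> 'v) \<Rightarrow> 'v set" where
  "real_interp \<theta> q X0 j0 X1 j1 =
     {x \<in> couple_sum X0 j0 X1 j1.
        ennpowr (\<integral>\<^sup>+ r\<in>{0<..}.
          ennreal ((r powr (-\<theta>) * K_functional X0 j0 X1 j1 r x) powr q / r) \<partial>lebesgue) (1 / q) < \<infinity>}"

section \<open>Time-Morrey spaces\<close>

definition strongly_measurable :: "'t measure \<Rightarrow> 'a::banach set \<Rightarrow> ('t \<Rightarrow> 'a) \<Rightarrow> bool" where
  "strongly_measurable M X f \<longleftrightarrow>
     f \<in> space M \<rightarrow> X \<and>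
     (\<exists>s. (\<forall>n. simple_function M (s n) \<and> s n \<in> space M \<rightarrow> X) \<and>
          (AE t in M. (\<lambda>n. s n t) \<longlonglongrightarrow> f t))"

text \<open>Intervals of length zero are left out, since \<open>0\<close> would be raised to a negative power.\<close>

definition morrey_norm :: "real \<Rightarrow> real \<Rightarrow> real \<Rightarrow> (real \<Rightarrow> 'a::banach) \<Rightarrow> ennreal" where
  "morrey_norm p lam T f =
     (SUP I \<in> {I. is_interval I \<and> I \<subseteq> {0<..<T} \<and> 0 < measure lebesgue I}.
        ennreal (measure lebesgue I powr (- lam / p)) *
        ennpowr (\<integral>\<^sup>+ t\<in>I. ennreal (norm (f t) powr p) \<partial>lebesgue) (1 / p))"

definition morrey :: "real \<Rightarrow> real \<Rightarrow> real \<Rightarrow> 'a::banach set \<Rightarrow> (real \<Rightarrow> 'a) set" where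
  "morrey p lam T X =
     {f. strongly_measurable (lebesgue_on {0<..<T}) X f \<and> morrey_norm p lam T f < \<infinity>}"

section \<open>The Morrey evolution class and its initial values\<close>

definition test_function :: "real \<Rightarrow> (real \<Rightarrow> real) \<Rightarrow> bool" where
  "test_function T \<phi> \<longleftrightarrow>
     (\<forall>n t. ((deriv ^^ n) \<phi>) field_differentiable (at t)) \<and>
     (\<exists>C. compact C \<and> C \<subseteq> {0<..<T} \<and> (\<forall>t. t \<notin> C \<longrightarrow> \<phi> t = 0))"

text \<open>The library's Bochner integral is restricted to second-countable types, which excludes
  \<open>cbdd\<close>. The relation below is its definition word for word, except that Borel measurability
  is replaced by strong measurability.\<close>

definition has_bochner :: "'t measure \<Rightarrow> ('t \<Rightarrow> 'a::banach) \<Rightarrow> 'a \<Rightarrow> bool" where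
  "has_bochner M f x \<longleftrightarrow>
     strongly_measurable M UNIV f \<and>
     (\<exists>s. (\<forall>n. Bochner_Integration.simple_bochner_integrable M (s n)) \<and>
          (\<lambda>n. \<integral>\<^sup>+ t. ennreal (norm (f t - s n t)) \<partial>M) \<longlonglongrightarrow> 0 \<and>
          (\<lambda>n. Bochner_Integration.simple_bochner_integral M (s n)) \<longlonglongrightarrow> x)"

definition distributional_derivative ::
  "real \<Rightarrow> (real \<Rightarrow> 'a::banach) \<Rightarrow> (real \<Rightarrow> 'a) \<Rightarrow> bool" where
  "distributional_derivative T f v \<longleftrightarrow>
     (\<forall>\<phi>. test_function T \<phi> \<longrightarrow>
        (\<exists>x. has_bochner (lebesgue_on {0<..<T}) (\<lambda>t. deriv \<phi> t *\<^sub>R f t) x \<and>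
             has_bochner (lebesgue_on {0<..<T}) (\<lambda>t. \<phi> t *\<^sub>R v t) (- x)))"

text \<open>Here and below, \<open>i\<close> is the continuous embedding of \<open>X1\<close> into \<open>X0\<close>.\<close>

definition evolution_class ::
  "real \<Rightarrow> real \<Rightarrow> real \<Rightarrow> 'a::banach set \<Rightarrow> 'b::banach set \<Rightarrow> ('b \<Rightarrow> 'a) \<Rightarrow> (real \<Rightarrow> 'b) set" where
  "evolution_class p lam T X0 X1 i =
     {u \<in> morrey p lam T X1.
        \<exists>v \<in> morrey p lam T X0. distributional_derivative T (\<lambda>t. i (u t)) v}"

definition abs_continuous_on_interval :: "real \<Rightarrow> real \<Rightarrow> (real \<Rightarrow> 'a::banach) \<Rightarrow> bool" where
  "abs_continuous_on_interval a b w \<longleftrightarrow>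
     (\<forall>\<epsilon>>0. \<exists>\<delta>>0. \<forall>(n::nat) s t.
        (\<forall>k<n. a \<le> s k \<and> s k \<le> t k \<and> t k \<le> b) \<and>
        disjoint_family_on (\<lambda>k. {s k<..<t k}) {..<n} \<and>
        (\<Sum>k<n. t k - s k) < \<delta> \<longrightarrow>
        (\<Sum>k<n. norm (w (t k) - w (s k))) < \<epsilon>)"

text \<open>\<open>x\<close> is the value \<open>u(0)\<close>; it is given as a relation, so that asserting it includes existence of the
  representative \<open>w\<close>; continuity of \<open>w\<close> makes \<open>x\<close> unique.\<close>

definition has_initial_value ::
  "real \<Rightarrow> 'a::banach set \<Rightarrow> ('b::banach \<Rightarrow> 'a) \<Rightarrow> (real \<Rightarrow> 'b) \<Rightarrow> 'a \<Rightarrow> bool" where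
  "has_initial_value T X0 i u x \<longleftrightarrow>
     (\<exists>w. w \<in> {0..T} \<rightarrow> X0 \<and> abs_continuous_on_interval 0 T w \<and>
          (AE t in lebesgue_on {0<..<T}. w t = i (u t)) \<and> w 0 = x)"

end

theory Submission
  imports Defs
begin

text \<open>Take \<open>X0\<close> and \<open>X1\<close> both equal to the space of bounded continuous functions on the
  line, with \<open>X1\<close> embedded through multiplication by \<open>1 / m\<close>, where \<open>m s = max 1 s\<close>; up to
  isometry this is the weighted space of all \<open>f\<close> with \<open>m f\<close> bounded. The orbit
  \<open>w t = m powr (- \<theta>) * exp (- t m)\<close> of the multiplication semigroup corresponds to the
  \<open>X1\<close>-valued function \<open>u t = m powr (1 - \<theta>) * exp (- t m)\<close>, and \<open>w' = - u\<close> in \<open>X0\<close>. Both norms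
  are thus at most \<open>t powr (\<theta> - 1) = t powr (- (1 - lam) / p)\<close>, which is exactly the growth that the
  Morrey condition allows. At \<open>t = 0\<close> the value is \<open>m powr (- \<theta>)\<close>; since \<open>1 / m\<close> attains
  every value \<open>r\<close> in \<open>(0, 1]\<close>, evaluation at such a point gives \<open>K(r) \<ge> r powr \<theta>\<close>, so that the
  interpolation integral dominates the divergent integral of \<open>1 / r\<close> near \<open>0\<close>.\<close>

section \<open>Continuous functions and the Bochner integral\<close>

text \<open>On a bounded interval the floor takes finitely many values on measurable level sets, and
  composing with a map into any type keeps both properties.\<close>

lemma simple_function_floor_step:
  fixes T c :: real
  assumes "0 < c"
  shows "simple_function (lebesgue_on {0<..<T}) (\<lambda>t. f \<lfloor>c * t\<rfloor>)"
proof -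
  have "(\<lambda>t. \<lfloor>c * t\<rfloor>) ` {0<..<T} \<subseteq> {0..\<lfloor>c * T\<rfloor>}"
    using assms by (auto intro!: floor_mono)
  then have "finite ((\<lambda>t. \<lfloor>c * t\<rfloor>) ` {0<..<T})"
    by (rule finite_subset) simp
  moreover have "(\<lambda>t. \<lfloor>c * t\<rfloor>) \<in> measurable lborel (count_space UNIV)"
    by measurable
  then have "(\<lambda>t. \<lfloor>c * t\<rfloor>) \<in> measurable (lebesgue_on {0<..<T}) (count_space UNIV)"
    by (intro measurable_restrict_space1 measurable_completion)
  ultimately have "simple_function (lebesgue_on {0<..<T}) (\<lambda>t. \<lfloor>c * t\<rfloor>)"
    by (simp add: simple_function_eq_measurable space_restrict_space)
  then show ?thesis
    using simple_function_compose[of _ _ f] by (simp add: o_def)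
qed

text \<open>Rounding up keeps the sample points of \<open>{0<..}\<close> inside \<open>{0<..}\<close>, where functions singular
  at \<open>0\<close> are still continuous.\<close>

definition right_step :: "nat \<Rightarrow> real \<Rightarrow> real" where
  "right_step n t = of_int (\<lfloor>real (Suc n) * t\<rfloor> + 1) / real (Suc n)"

lemma right_step_bounds: "t < right_step n t" "right_step n t \<le> t + 1 / real (Suc n)"
proof -
  have 1: "real (Suc n) * t < of_int (\<lfloor>real (Suc n) * t\<rfloor> + 1)"
    by linarith
  show "t < right_step n t"
    using 1 unfolding right_step_def by (simp add: pos_less_divide_eq mult.commute del: of_nat_Suc)
  have 2: "of_int (\<lfloor>real (Suc n) * t\<rfloor> + 1) \<le> real (Suc n) * t + 1"
    by linarith
  have "right_step n t \<le> (real (Suc n) * t + 1) / real (Suc n)"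
    unfolding right_step_def by (rule divide_right_mono[OF 2]) simp
  then show "right_step n t \<le> t + 1 / real (Suc n)"
    by (simp add: add_divide_distrib del: of_nat_Suc)
qed

lemma right_step_tendsto: "(\<lambda>n. right_step n t) \<longlonglongrightarrow> t"
proof (rule tendsto_sandwich[where f = "\<lambda>_. t" and h = "\<lambda>n. t + 1 / real (Suc n)"])
  show "(\<lambda>n. t + 1 / real (Suc n)) \<longlonglongrightarrow> t"
    using tendsto_add[OF tendsto_const[of t] LIMSEQ_inverse_real_of_nat]
    by (simp add: inverse_eq_divide)
qed (use right_step_bounds[where t = t] in \<open>auto intro!: always_eventually intro: less_imp_le simp del: of_nat_Suc\<close>)

lemma simple_function_right_step: "simple_function (lebesgue_on {0<..<T}) (\<lambda>t. f (right_step n t))"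
  unfolding right_step_def
  by (rule simple_function_floor_step[where f = "\<lambda>k. f (of_int (k + 1) / real (Suc n))"]) simp

text \<open>Sampling at \<open>right_step n t\<close> gives simple functions, which converge at
  every \<open>t > 0\<close> by continuity there.\<close>

lemma strongly_measurable_continuous:
  fixes f :: "real \<Rightarrow> 'a::banach"
  assumes "continuous_on {0<..} f"
  shows "strongly_measurable (lebesgue_on {0<..<T}) UNIV f"
  unfolding strongly_measurable_def
proof (intro conjI exI[of _ "\<lambda>n t. f (right_step n t)"])
  have "(\<lambda>n. f (right_step n t)) \<longlonglongrightarrow> f t" if "0 < t" for t
  proof (rule isCont_tendsto_compose[OF _ right_step_tendsto])
    show "isCont f t"
      using assms that by (simp add: continuous_on_eq_continuous_at)
  qed
  then show "AE t in lebesgue_on {0<..<T}. (\<lambda>n. f (right_step n t)) \<longlonglongrightarrow> f t"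
    by (intro AE_I2) (simp add: space_restrict_space)
qed (simp_all add: simple_function_right_step)

text \<open>A simple function is a finite sum of indicators of its level sets times values, and each
  summand integrates to measure times value. This links Bochner sums to the gauge integral, for
  which the fundamental theorem of calculus is at hand.\<close>

lemma simple_bochner_integral_has_integral:
  fixes s :: "real \<Rightarrow> 'a::real_normed_vector"
  assumes S: "S \<in> lmeasurable" and s: "simple_function (lebesgue_on S) s"
  shows "(s has_integral Bochner_Integration.simple_bochner_integral (lebesgue_on S) s) S"
proof -
  have sp: "space (lebesgue_on S) = S"
    by (simp add: space_restrict_space)
  have fin: "finite (s ` S)"
    using s by (simp add: simple_function_def sp)
  have piece: "((\<lambda>t. indicator {t \<in> S. s t = y} t *\<^sub>R y) has_integral
      (measure (lebesgue_on S) {t \<in> S. s t = y} *\<^sub>R y)) S" if "y \<in> s ` S" for y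
  proof -
    let ?A = "{t \<in> S. s t = y}"
    have A: "?A = s -` {y} \<inter> space (lebesgue_on S)"
      by (auto simp: sp)
    have "?A \<in> sets (lebesgue_on S)"
      unfolding A using s that by (auto simp: simple_function_def sp)
    then have "?A \<in> sets lebesgue"
      using S by (auto simp: sets_restrict_space_iff fmeasurableD)
    then have "?A \<in> lmeasurable"
      using S by (intro fmeasurableI2[OF S]) auto
    then have "((indicator ?A :: real \<Rightarrow> real) has_integral measure lebesgue ?A) UNIV"
      by (simp add: lmeasurable_iff_has_integral)
    moreover have "(indicator ?A :: real \<Rightarrow> real) = (\<lambda>t. if t \<in> S then indicator ?A t else 0)"
      by (auto simp: indicator_def)
    ultimately have "((indicator ?A :: real \<Rightarrow> real) has_integral measure lebesgue ?A) S"
      using has_integral_restrict_UNIV[of S "indicator ?A :: real \<Rightarrow> real"] by simp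
    moreover have "measure (lebesgue_on S) ?A = measure lebesgue ?A"
      using S by (intro measure_restrict_space) auto
    ultimately show ?thesis
      by (intro has_integral_scaleR_left) simp
  qed
  have "((\<lambda>t. \<Sum>y\<in>s ` S. indicator {t \<in> S. s t = y} t *\<^sub>R y) has_integral
      Bochner_Integration.simple_bochner_integral (lebesgue_on S) s) S"
    unfolding simple_bochner_integral_def sp by (intro has_integral_sum fin piece)
  moreover have "(\<Sum>y\<in>s ` S. indicator {t \<in> S. s t = y} t *\<^sub>R y) = s t" if "t \<in> S" for t
  proof -
    have "(\<Sum>y\<in>s ` S. indicator {t \<in> S. s t = y} t *\<^sub>R y) =
        (\<Sum>y\<in>s ` S. if y = s t then y else 0)"
      using that by (intro sum.cong) (auto simp: indicator_def)
    then show ?thesis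
      using fin that by simp
  qed
  ultimately show ?thesis
    by (rule has_integral_eq[rotated]) 
qed

text \<open>Uniform continuity makes the step functions converge uniformly on \<open>{0..T}\<close>;
  as the interval has finite length, this yields both the \<open>L1\<close> convergence and the
  convergence of the integrals.\<close>

lemma has_bochner_continuous:
  fixes f :: "real \<Rightarrow> 'a::banach"
  assumes f: "continuous_on UNIV f" and T: "0 < T"
  shows "has_bochner (lebesgue_on {0<..<T}) f (integral {0..T} f)"
proof -
  let ?M = "lebesgue_on {0<..<T}" and ?s = "\<lambda>n t. f (right_step n t)"
  have sm: "simple_function ?M (?s n)" for n
    by (rule simple_function_right_step)
  have emT: "emeasure ?M {0<..<T} = ennreal T"
    using T by (simp add: emeasure_restrict_space)
  have sb: "Bochner_Integration.simple_bochner_integrable ?M (?s n)" for n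
  proof (rule simple_bochner_integrable.intros[OF sm])
    have "emeasure ?M {t \<in> space ?M. ?s n t \<noteq> 0} \<le> emeasure ?M (space ?M)"
      by (rule emeasure_space)
    then show "emeasure ?M {t \<in> space ?M. ?s n t \<noteq> 0} \<noteq> \<infinity>"
      using emT by (auto simp: space_restrict_space top_unique)
  qed
  have close: "\<exists>N. \<forall>n\<ge>N. \<forall>t\<in>{0..T}. norm (f t - ?s n t) \<le> e" if e: "0 < e" for e
  proof -
    \<comment> \<open>Rounding up may leave \<open>{0..T}\<close>, but by at most
      \<open>1 / Suc n\<close>, hence at most 1.\<close>
    have "uniformly_continuous_on {0..T + 1} f"
      by (intro compact_uniformly_continuous continuous_on_subset[OF f]) auto
    then obtain d where d: "0 < d"
      "\<And>x y. x \<in> {0..T + 1} \<Longrightarrow> y \<in> {0..T + 1} \<Longrightarrow> dist y x < d \<Longrightarrow> dist (f y) (f x) < e"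
      using e unfolding uniformly_continuous_on_def by metis
    obtain N where N: "1 / real (Suc N) < d"
      using reals_Archimedean[OF \<open>0 < d\<close>] by (auto simp: inverse_eq_divide)
    show ?thesis
    proof (intro exI[of _ N] allI impI ballI)
      fix n t assume n: "N \<le> n" and t: "t \<in> {0..T}"
      have "1 / real (Suc n) \<le> 1 / real (Suc N)" "1 / real (Suc n) \<le> 1"
        using n by (auto simp: field_simps)
      then have "right_step n t \<in> {0..T + 1}" "dist t (right_step n t) < d"
        using right_step_bounds(1)[of t n] right_step_bounds(2)[of n t] t N
        unfolding dist_real_def atLeastAtMost_iff by linarith+
      then show "norm (f t - ?s n t) \<le> e"
        using d(2)[of "right_step n t" t] t by (simp add: dist_norm less_imp_le)
    qed
  qed
  have lim_L1: "(\<lambda>n. \<integral>\<^sup>+ t. ennreal (norm (f t - ?s n t)) \<partial>?M) \<longlonglongrightarrow> 0"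
  proof (rule order_tendstoI)
    fix a :: ennreal assume "0 < a"
    then obtain c where "0 < c" "c < a"
      using dense by blast
    then obtain r where r: "0 < r" "ennreal r < a"
      by (cases c) auto
    obtain N where N: "\<And>n t. N \<le> n \<Longrightarrow> t \<in> {0..T} \<Longrightarrow> norm (f t - ?s n t) \<le> r / T"
      using close[of "r / T"] r T by (meson divide_pos_pos)
    have "(\<integral>\<^sup>+ t. ennreal (norm (f t - ?s n t)) \<partial>?M) < a" if "N \<le> n" for n
    proof -
      have "(\<integral>\<^sup>+ t. ennreal (norm (f t - ?s n t)) \<partial>?M) \<le> (\<integral>\<^sup>+ t. ennreal (r / T) \<partial>?M)"
        using N[OF that] by (intro nn_integral_mono) (simp add: space_restrict_space ennreal_leI)
      also have "\<dots> = ennreal r"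
        using r T emT by (simp add: space_restrict_space flip: ennreal_mult)
      finally show ?thesis
        using r by simp
    qed
    then show "\<forall>\<^sub>F n in sequentially. (\<integral>\<^sup>+ t. ennreal (norm (f t - ?s n t)) \<partial>?M) < a"
      by (auto simp: eventually_sequentially)
  qed simp
  have lim_int: "(\<lambda>n. Bochner_Integration.simple_bochner_integral ?M (?s n)) \<longlonglongrightarrow> integral {0..T} f"
  proof (rule LIMSEQ_I)
    fix e :: real assume "0 < e"
    then obtain N where N: "\<And>n t. N \<le> n \<Longrightarrow> t \<in> {0..T} \<Longrightarrow> norm (f t - ?s n t) \<le> e / (2 * T)"
      using close[of "e / (2 * T)"] T by (meson divide_pos_pos mult_pos_pos zero_less_numeral)
    have "norm (Bochner_Integration.simple_bochner_integral ?M (?s n) - integral {0..T} f) < e"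
      if "N \<le> n" for n
    proof -
      have "(?s n has_integral Bochner_Integration.simple_bochner_integral ?M (?s n)) {0<..<T}"
        by (rule simple_bochner_integral_has_integral[OF _ sm]) simp
      then have "(?s n has_integral Bochner_Integration.simple_bochner_integral ?M (?s n)) {0..T}"
        by (simp add: has_integral_Icc_iff_Ioo)
      moreover have "(f has_integral integral {0..T} f) {0..T}"
        by (intro integrable_integral integrable_continuous_interval continuous_on_subset[OF f]) auto
      ultimately have "((\<lambda>t. f t - ?s n t) has_integral
          (integral {0..T} f - Bochner_Integration.simple_bochner_integral ?M (?s n))) {0..T}"
        by (intro has_integral_diff)
      then have "norm (integral {0..T} f - Bochner_Integration.simple_bochner_integral ?M (?s n))
          \<le> e / (2 * T) * measure lborel (cbox 0 T)"
        using N[OF that] T \<open>0 < e\<close> by (intro has_integral_bound[where f = "\<lambda>t. f t - ?s n t"]) auto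
      also have "\<dots> < e"
        using T \<open>0 < e\<close> by simp
      finally show ?thesis
        by (simp add: norm_minus_commute)
    qed
    then show "\<exists>N. \<forall>n\<ge>N. norm (Bochner_Integration.simple_bochner_integral ?M (?s n)
        - integral {0..T} f) < e"
      by blast
  qed
  show ?thesis
    unfolding has_bochner_def using sb lim_L1 lim_int
    by (intro conjI strongly_measurable_continuous exI[of _ ?s] continuous_on_subset[OF f]) auto
qed

text \<open>The product is zero on the open set \<open>- C\<close> and continuous on the open
  half-line, and these two cover the real line. Thus a cutoff removes a singularity of
  \<open>g\<close> at 0 and arbitrary values of \<open>g\<close> to the left of it.\<close>

lemma continuous_cutoff:
  fixes g :: "real \<Rightarrow> 'a::real_normed_vector"
  assumes \<psi>: "continuous_on UNIV \<psi>" and g: "continuous_on {0<..} g"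
    and C: "closed C" "C \<subseteq> {0<..}" "\<And>t. t \<notin> C \<Longrightarrow> \<psi> t = 0"
  shows "continuous_on UNIV (\<lambda>t. \<psi> t *\<^sub>R g t)"
proof -
  have "continuous_on (- C) (\<lambda>t. \<psi> t *\<^sub>R g t)"
    by (rule continuous_on_eq[OF continuous_on_const[of _ 0]]) (simp add: C)
  moreover have "continuous_on {0<..} (\<lambda>t. \<psi> t *\<^sub>R g t)"
    by (intro continuous_intros g continuous_on_subset[OF \<psi>]) auto
  ultimately have "continuous_on (- C \<union> {0<..}) (\<lambda>t. \<psi> t *\<^sub>R g t)"
    using C by (intro continuous_on_open_Un) auto
  moreover have "- C \<union> {0<..} = UNIV"
    using C by auto
  ultimately show ?thesis
    by simp
qed

section \<open>Absolute continuity of Hoelder-type functions\<close>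

text \<open>The increments are the lengths of the image intervals, which are again disjoint.\<close>

lemma sum_mono_increments_le:
  fixes G :: "real \<Rightarrow> real"
  assumes G: "mono_on {a..b} G" and ab: "a \<le> b"
    and st: "\<And>k. k < n \<Longrightarrow> a \<le> s k \<and> s k \<le> t k \<and> t k \<le> b"
    and disj: "disjoint_family_on (\<lambda>k. {s k<..<t k}) {..<n::nat}"
  shows "(\<Sum>k<n. G (t k) - G (s k)) \<le> G b - G a"
proof -
  let ?J = "\<lambda>k. {G (s k)<..<G (t k)}"
  have le: "G x \<le> G y" if "a \<le> x" "x \<le> y" "y \<le> b" for x y
    using G that by (auto simp: mono_on_def)
  have "disjoint_family_on ?J {..<n}"
    unfolding disjoint_family_on_def
  proof (intro ballI impI)
    fix k l assume kl: "k \<in> {..<n}" "l \<in> {..<n}" "k \<noteq> l"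
    then have "{s k<..<t k} \<inter> {s l<..<t l} = {}"
      using disj by (auto simp: disjoint_family_on_def)
    \<comment> \<open>Degenerate intervals have empty images; nondegenerate ones are ordered, and a
      monotone \<open>G\<close> preserves the order.\<close>
    then have "s k = t k \<or> s l = t l \<or> t k \<le> s l \<or> t l \<le> s k"
      using st[of k] st[of l] kl by (auto simp: Int_greaterThanLessThan greaterThanLessThan_empty_iff)
    then show "?J k \<inter> ?J l = {}"
      using le[of "t k" "s l"] le[of "t l" "s k"] st[of k] st[of l] kl by auto
  qed
  then have "measure lebesgue (\<Union>k<n. ?J k) = (\<Sum>k<n. measure lebesgue (?J k))"
    by (intro measure_finite_Union) (auto simp: st le)
  also have "\<dots> = (\<Sum>k<n. G (t k) - G (s k))"
    using st le by (intro sum.cong) auto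
  finally have "(\<Sum>k<n. G (t k) - G (s k)) = measure lebesgue (\<Union>k<n. ?J k)" ..
  also have "\<dots> \<le> measure lebesgue {G a..G b}"
  proof (rule measure_mono_fmeasurable)
    show "(\<Union>k<n. ?J k) \<subseteq> {G a..G b}"
    proof
      fix x assume "x \<in> (\<Union>k<n. ?J k)"
      then obtain k where "k < n" "x \<in> ?J k" by auto
      then show "x \<in> {G a..G b}"
        using st[of k] le[of a "s k"] le[of "t k" b] by auto
    qed
  qed auto
  also have "\<dots> = G b - G a"
    using le[of a b] ab by simp
  finally show ?thesis .
qed

text \<open>The slope of the power is at most \<open>\<theta> * h powr (\<theta> - 1)\<close> beyond \<open>h\<close>, while its total variation
  on \<open>{0..h}\<close> is small with \<open>h\<close>.\<close>

lemma powr_increment_le: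
  fixes \<theta> h s t :: real
  assumes \<theta>: "0 < \<theta>" "\<theta> \<le> 1" and h: "0 < h" and st: "0 \<le> s" "s \<le> t"
  shows "t powr \<theta> - s powr \<theta> \<le> \<theta> * h powr (\<theta> - 1) * (t - s) + (min t h powr \<theta> - min s h powr \<theta>)"
proof -
  have tail: "y powr \<theta> - x powr \<theta> \<le> \<theta> * h powr (\<theta> - 1) * (y - x)" if "h \<le> x" "x \<le> y" for x y
  proof -
    \<comment> \<open>Rearranged claim: the line with the slope of the power at \<open>h\<close>,
      minus the power, is nondecreasing beyond \<open>h\<close>, since \<theta> \<le> 1 makes that
      slope decrease.\<close>
    have "\<theta> * h powr (\<theta> - 1) * x - x powr \<theta> \<le> \<theta> * h powr (\<theta> - 1) * y - y powr \<theta>"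
    proof (rule DERIV_nonneg_imp_nondecreasing[OF that(2)])
      fix z assume z: "x \<le> z" "z \<le> y"
      have "((\<lambda>z. \<theta> * h powr (\<theta> - 1) * z - z powr \<theta>) has_real_derivative
          (\<theta> * h powr (\<theta> - 1) - \<theta> * z powr (\<theta> - 1))) (at z)"
        using z that h by (intro DERIV_diff DERIV_cmult_Id has_real_derivative_powr) auto
      moreover have "z powr (\<theta> - 1) \<le> h powr (\<theta> - 1)"
        using z that h \<theta> by (intro powr_mono2') auto
      then have "0 \<le> \<theta> * h powr (\<theta> - 1) - \<theta> * z powr (\<theta> - 1)"
        using \<theta> by (simp add: mult_left_mono)
      ultimately show "\<exists>D. ((\<lambda>z. \<theta> * h powr (\<theta> - 1) * z - z powr \<theta>) has_real_derivative D) (at z) \<and> 0 \<le> D"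
        by blast
    qed
    then show ?thesis
      by (simp add: algebra_simps)
  qed
  show ?thesis
  proof (cases "t \<le> h \<or> h \<le> s")
    case True
    then consider "t \<le> h" | "h < t" "h \<le> s"
      by linarith
    then show ?thesis
    proof cases
      case 1
      then have "min t h = t" "min s h = s"
        using st by auto
      moreover have "0 \<le> \<theta> * h powr (\<theta> - 1) * (t - s)"
        using st \<theta> by simp
      ultimately show ?thesis
        by simp
    next
      case 2
      then have "min t h = h" "min s h = h"
        by auto
      then show ?thesis
        using tail[OF 2(2) st(2)] by simp
    qed
  next
    \<comment> \<open>Here \<open>s < h < t\<close>: the part up to \<open>h\<close> is the
      \<open>min\<close> term exactly, and the rest is covered by the slope bound.\<close>
    case False
    then have "min t h = h" "min s h = s"
      by auto
    moreover have "\<theta> * h powr (\<theta> - 1) * (t - h) \<le> \<theta> * h powr (\<theta> - 1) * (t - s)"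
      using \<theta> False by (intro mult_left_mono) auto
    ultimately show ?thesis
      using tail[of h t] False by simp
  qed
qed

text \<open>After splitting the power at \<open>h\<close>, the steep part contributes at most
  \<open>c * h powr \<theta>\<close> in total, however many intervals there are, and the rest is
  Lipschitz.\<close>

lemma abs_continuous_on_interval_powr_bound:
  fixes w :: "real \<Rightarrow> 'a::banach"
  assumes \<theta>: "0 < \<theta>" "\<theta> \<le> 1" and T: "0 \<le> T" and c: "0 < c"
    and w: "\<And>s t. 0 \<le> s \<Longrightarrow> s \<le> t \<Longrightarrow> t \<le> T \<Longrightarrow> norm (w t - w s) \<le> c * (t powr \<theta> - s powr \<theta>)"
  shows "abs_continuous_on_interval 0 T w"
  unfolding abs_continuous_on_interval_def
proof (intro allI impI)
  fix e :: real assume e: "0 < e"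
  \<comment> \<open>With this \<open>h\<close> the steep part costs at most \<open>e / 2\<close>;
    the bound \<open>e / (2 * c * L)\<close> on the total length leaves less than
    \<open>e / 2\<close> for the Lipschitz part.\<close>
  define h where "h = (e / (2 * c)) powr (1 / \<theta>)"
  have h: "0 < h" "h powr \<theta> = e / (2 * c)"
    using e c \<theta> by (auto simp: h_def powr_powr)
  define L where "L = \<theta> * h powr (\<theta> - 1)"
  have L: "0 < L"
    using \<theta> h by (simp add: L_def)
  show "\<exists>d>0. \<forall>(n::nat) s t. (\<forall>k<n. 0 \<le> s k \<and> s k \<le> t k \<and> t k \<le> T) \<and>
      disjoint_family_on (\<lambda>k. {s k<..<t k}) {..<n} \<and> (\<Sum>k<n. t k - s k) < d \<longrightarrow>
      (\<Sum>k<n. norm (w (t k) - w (s k))) < e"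
  proof (intro exI[of _ "e / (2 * c * L)"] conjI, goal_cases)
    case 1
    show ?case
      using e c L by simp
  next
    case 2
    show ?case
    proof (intro allI impI, elim conjE)
      fix n :: nat and s t :: "nat \<Rightarrow> real"
      assume st: "\<forall>k<n. 0 \<le> s k \<and> s k \<le> t k \<and> t k \<le> T"
        and disj: "disjoint_family_on (\<lambda>k. {s k<..<t k}) {..<n}"
        and small: "(\<Sum>k<n. t k - s k) < e / (2 * c * L)"
      let ?G = "\<lambda>x. min x h powr \<theta>"
      have "(\<Sum>k<n. ?G (t k) - ?G (s k)) \<le> ?G T - ?G 0"
      proof (rule sum_mono_increments_le[OF _ T _ disj])
        show "mono_on {0..T} ?G"
          using \<theta> h by (intro mono_onI powr_mono2) auto
      qed (use st in auto)
      also have "\<dots> \<le> h powr \<theta>"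
        using h(1) T \<theta> by (simp add: powr_mono2)
      finally have G: "(\<Sum>k<n. ?G (t k) - ?G (s k)) \<le> e / (2 * c)"
        using h by simp
      have "(\<Sum>k<n. norm (w (t k) - w (s k))) \<le> (\<Sum>k<n. c * (L * (t k - s k) + (?G (t k) - ?G (s k))))"
      proof (rule sum_mono)
        fix k assume "k \<in> {..<n}"
        then have k: "0 \<le> s k" "s k \<le> t k" "t k \<le> T"
          using st by auto
        have "norm (w (t k) - w (s k)) \<le> c * (t k powr \<theta> - s k powr \<theta>)"
          by (rule w[OF k])
        also have "\<dots> \<le> c * (L * (t k - s k) + (?G (t k) - ?G (s k)))"
          using powr_increment_le[OF \<theta> h(1) k(1,2)] c unfolding L_def by (intro mult_left_mono) auto
        finally show "norm (w (t k) - w (s k)) \<le> c * (L * (t k - s k) + (?G (t k) - ?G (s k)))" .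
      qed
      also have "\<dots> = c * L * (\<Sum>k<n. t k - s k) + c * (\<Sum>k<n. ?G (t k) - ?G (s k))"
        by (simp only: sum_distrib_left sum.distrib[symmetric]) (simp add: algebra_simps)
      also have "\<dots> < c * L * (e / (2 * c * L)) + c * (e / (2 * c))"
        using small G c L by (intro add_less_le_mono mult_strict_left_mono mult_left_mono) auto
      also have "\<dots> = e"
        using c L by simp
      finally show "(\<Sum>k<n. norm (w (t k) - w (s k))) < e" .
    qed
  qed
qed

section \<open>Power bounds for Morrey and interpolation norms\<close>

text \<open>Split at \<open>l\<close>, the measure of \<open>I\<close>: the integral over
  \<open>{0..l}\<close> is \<open>l powr lam / lam\<close>, and beyond \<open>l\<close> the
  integrand is at most \<open>l powr (lam - 1)\<close> on a set of measure at most
  \<open>l\<close>.\<close>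

lemma nn_integral_powr_le_measure:
  fixes lam :: real
  assumes lam: "0 < lam" "lam < 1"
    and I: "I \<in> lmeasurable" "I \<subseteq> {0<..}" and pos: "0 < measure lebesgue I"
  shows "(\<integral>\<^sup>+ t\<in>I. ennreal (t powr (lam - 1)) \<partial>lebesgue)
    \<le> ennreal ((1 / lam + 1) * measure lebesgue I powr lam)"
proof -
  define l where "l = measure lebesgue I"
  have l: "0 < l"
    using pos by (simp add: l_def)
  have em: "emeasure lebesgue I = ennreal l"
    using I by (simp add: l_def emeasure_eq_measure2)
  have near: "(\<integral>\<^sup>+ t. ennreal (t powr (lam - 1)) * indicator {0..l} t \<partial>lebesgue) = ennreal (l powr lam / lam)"
    using nn_integral_has_integral_lebesgue'[OF _ has_integral_powr_from_0[of "lam - 1" l]] lam l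
    by (simp add: nn_integral_completion)
  have "(\<integral>\<^sup>+ t\<in>I. ennreal (t powr (lam - 1)) \<partial>lebesgue) \<le>
      (\<integral>\<^sup>+ t. ennreal (t powr (lam - 1)) * indicator {0..l} t + ennreal (l powr (lam - 1)) * indicator I t \<partial>lebesgue)"
  proof (rule nn_integral_mono)
    fix t
    show "ennreal (t powr (lam - 1)) * indicator I t \<le>
        ennreal (t powr (lam - 1)) * indicator {0..l} t + ennreal (l powr (lam - 1)) * indicator I t"
    proof (cases "t \<le> l \<or> t \<notin> I")
      case True
      then show ?thesis
        using I by (auto simp: indicator_def)
    next
      case False
      then have "t powr (lam - 1) \<le> l powr (lam - 1)"
        using l lam by (intro powr_mono2') auto
      then show ?thesis
        using False by (simp add: ennreal_leI)
    qed
  qed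
  also have "\<dots> = ennreal (l powr lam / lam) + ennreal (l powr (lam - 1)) * ennreal l"
    using I by (subst nn_integral_add) (auto simp: near em nn_integral_cmult_indicator fmeasurableD intro!: measurable_completion)
  also have "\<dots> = ennreal (l powr lam / lam + l powr (lam - 1) * l)"
    using l lam by (simp add: ennreal_mult ennreal_plus)
  also have "l powr lam / lam + l powr (lam - 1) * l = (1 / lam + 1) * l powr lam"
    using l by (simp add: powr_diff field_simps)
  finally show ?thesis
    by (simp add: l_def)
qed

text \<open>The \<open>p\<close>-th power of the bound is \<open>t powr (lam - 1)\<close>, whose
  integral over \<open>I\<close> is of order \<open>lam\<close> in the length; after the
  \<open>p\<close>-th root this cancels the Morrey weight.\<close>

lemma morrey_powr_bound:
  fixes f :: "real \<Rightarrow> 'a::banach"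
  assumes lam: "0 < lam" "lam < 1" and p: "1 < p"
    and sm: "strongly_measurable (lebesgue_on {0<..<T}) X f"
    and f: "\<And>t. 0 < t \<Longrightarrow> t < T \<Longrightarrow> norm (f t) \<le> t powr (- ((1 - lam) / p))"
  shows "f \<in> morrey p lam T X"
proof -
  let ?C = "(1 / lam + 1) powr (1 / p)"
  have "morrey_norm p lam T f \<le> ennreal ?C"
    unfolding morrey_norm_def
  proof (rule SUP_least)
    fix I assume *: "I \<in> {I. is_interval I \<and> I \<subseteq> {0<..<T} \<and> 0 < measure lebesgue I}"
    have I: "is_interval I" "I \<subseteq> {0<..<T}" and pos: "0 < measure lebesgue I"
      using * by blast+
    define l where "l = measure lebesgue I"
    have "bounded I"
      by (rule bounded_subset[OF _ I(2)]) simp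
    then have meas: "I \<in> lmeasurable"
      by (intro measurable_convex is_interval_convex I)
    have "(\<integral>\<^sup>+ t\<in>I. ennreal (norm (f t) powr p) \<partial>lebesgue) \<le> (\<integral>\<^sup>+ t\<in>I. ennreal (t powr (lam - 1)) \<partial>lebesgue)"
    proof (rule nn_integral_mono)
      fix t
      show "ennreal (norm (f t) powr p) * indicator I t \<le> ennreal (t powr (lam - 1)) * indicator I t"
      proof (cases "t \<in> I")
        case True
        then have "norm (f t) powr p \<le> (t powr (- ((1 - lam) / p))) powr p"
          using I f p by (intro powr_mono2) auto
        also have "\<dots> = t powr (lam - 1)"
          using p by (simp add: powr_powr)
        finally show ?thesis
          using True by (simp add: ennreal_leI)
      qed simp
    qed
    also have "\<dots> \<le> ennreal ((1 / lam + 1) * l powr lam)"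
      unfolding l_def using I by (intro nn_integral_powr_le_measure lam pos meas) auto
    \<comment> \<open>The integral is finite, so \<open>ennpowr\<close> acts as the ordinary real
      power.\<close>
    finally obtain r where r: "(\<integral>\<^sup>+ t\<in>I. ennreal (norm (f t) powr p) \<partial>lebesgue) = ennreal r"
        "0 \<le> r" "r \<le> (1 / lam + 1) * l powr lam"
      using lam by (cases "\<integral>\<^sup>+ t\<in>I. ennreal (norm (f t) powr p) \<partial>lebesgue")
        (auto simp: top_unique)
    have "l powr (- lam / p) * r powr (1 / p) \<le> l powr (- lam / p) * ((1 / lam + 1) * l powr lam) powr (1 / p)"
      using r p by (intro mult_left_mono powr_mono2) auto
    also have "\<dots> = ?C"
      using pos lam by (simp add: l_def powr_mult powr_powr powr_add[symmetric])
    finally show "ennreal (measure lebesgue I powr (- lam / p)) *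
        ennpowr (\<integral>\<^sup>+ t\<in>I. ennreal (norm (f t) powr p) \<partial>lebesgue) (1 / p) \<le> ennreal ?C"
      using r by (simp add: ennpowr_def ennreal_mult[symmetric] ennreal_leI l_def)
  qed
  then have "morrey_norm p lam T f < \<infinity>"
    by (simp add: le_less_trans[OF _ ennreal_less_top])
  then show ?thesis
    using sm by (simp add: morrey_def)
qed

text \<open>The part over \<open>{exp (- n)..1}\<close> already contributes exactly
  \<open>n\<close>.\<close>

lemma nn_integral_inverse_top:
  "(\<integral>\<^sup>+ r\<in>{0<..1}. ennreal (1 / r) \<partial>lebesgue) = \<infinity>"
proof -
  have ge: "ennreal (real n) \<le> (\<integral>\<^sup>+ r\<in>{0<..1}. ennreal (1 / r) \<partial>lebesgue)" for n
  proof -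
    have "((\<lambda>r. 1 / r) has_integral (ln 1 - ln (exp (- real n)))) {exp (- real n)..1}"
    proof (rule fundamental_theorem_of_calculus)
      fix x assume "x \<in> {exp (- real n)..1}"
      then have "0 < x"
        using less_le_trans[OF exp_gt_zero] by auto
      then show "(ln has_vector_derivative 1 / x) (at x within {exp (- real n)..1})"
        by (auto intro!: derivative_eq_intros simp flip: has_real_derivative_iff_has_vector_derivative)
    qed simp
    moreover have "0 \<le> 1 / r" if "r \<in> {exp (- real n)..1}" for r
      using that less_le_trans[OF exp_gt_zero] by (auto simp: less_imp_le)
    ultimately have "ennreal (real n) = (\<integral>\<^sup>+ r. ennreal (1 / r) * indicator {exp (- real n)..1} r \<partial>lborel)"
      using nn_integral_has_integral_lebesgue'[of "{exp (- real n)..1}" "\<lambda>r. 1 / r" "real n"] by simp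
    also have "\<dots> = (\<integral>\<^sup>+ r. ennreal (1 / r) * indicator {exp (- real n)..1} r \<partial>lebesgue)"
      by (simp add: nn_integral_completion)
    also have "\<dots> \<le> (\<integral>\<^sup>+ r\<in>{0<..1}. ennreal (1 / r) \<partial>lebesgue)"
      using exp_gt_zero[of "- real n"]
      by (intro nn_integral_mono mult_left_mono)
        (auto simp: indicator_def simp del: exp_gt_zero dest: less_le_trans)
    finally show ?thesis .
  qed
  have "(\<integral>\<^sup>+ r\<in>{0<..1}. ennreal (1 / r) \<partial>lebesgue) = top"
  proof (rule ccontr)
    assume "\<not> ?thesis"
    then obtain x where x: "0 \<le> x" "(\<integral>\<^sup>+ r\<in>{0<..1}. ennreal (1 / r) \<partial>lebesgue) = ennreal x"
      by (cases "(\<integral>\<^sup>+ r\<in>{0<..1}. ennreal (1 / r) \<partial>lebesgue)") auto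
    obtain n where "x < real n"
      using reals_Archimedean2 by blast
    then show False
      using ge[of n] x by simp
  qed
  then show ?thesis by simp
qed


text \<open>On \<open>{0<..1}\<close> the weighted functional is at least 1, so its
  \<open>q\<close>-th power divided by \<open>r\<close> dominates \<open>1 / r\<close>.\<close>

lemma not_in_real_interp:
  assumes q: "1 \<le> q"
    and K: "\<And>r. 0 < r \<Longrightarrow> r \<le> 1 \<Longrightarrow> r powr \<theta> \<le> K_functional X0 j0 X1 j1 r x"
  shows "x \<notin> real_interp \<theta> q X0 j0 X1 j1"
proof -
  let ?f = "\<lambda>r. (r powr (-\<theta>) * K_functional X0 j0 X1 j1 r x) powr q / r"
  have le: "1 / r \<le> ?f r" if "0 < r" "r \<le> 1" for r
  proof -
    have "1 = r powr (-\<theta>) * r powr \<theta>"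
      using that by (simp flip: powr_add)
    also have "\<dots> \<le> r powr (-\<theta>) * K_functional X0 j0 X1 j1 r x"
      by (rule mult_left_mono[OF K[OF that]]) simp
    finally have "1 \<le> (r powr (-\<theta>) * K_functional X0 j0 X1 j1 r x) powr q"
      using q by (simp add: ge_one_powr_ge_zero)
    then show ?thesis
      using that by (simp add: divide_right_mono)
  qed
  have "\<infinity> = (\<integral>\<^sup>+ r\<in>{0<..1}. ennreal (1 / r) \<partial>lebesgue)"
    by (simp add: nn_integral_inverse_top)
  also have "\<dots> \<le> (\<integral>\<^sup>+ r\<in>{0<..}. ennreal (?f r) \<partial>lebesgue)"
    using le by (intro nn_integral_mono) (auto simp: indicator_def intro!: ennreal_leI)
  finally have "(\<integral>\<^sup>+ r\<in>{0<..}. ennreal (?f r) \<partial>lebesgue) = \<infinity>"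
    by (simp add: top_unique)
  then show ?thesis
    unfolding real_interp_def by (simp add: ennpowr_def)
qed

section \<open>The multiplication semigroup\<close>

text \<open>Raise \<open>x \<le> exp x\<close> at \<open>x = t * m / a\<close> to the power
  \<open>a\<close>. Being uniform in \<open>m\<close>, this is the smoothing estimate of the
  semigroup.\<close>

lemma powr_mult_exp_le:
  fixes a t m :: real
  assumes "0 < a" "0 < t" "0 < m"
  shows "m powr a * exp (- (t * m)) \<le> (a / t) powr a"
proof -
  have "t * m / a \<le> exp (t * m / a)"
    using exp_ge_add_one_self[of "t * m / a"] by linarith
  then have "m \<le> (a / t) * exp (t * m / a)"
    using assms by (simp add: field_simps)
  then have "m powr a \<le> ((a / t) * exp (t * m / a)) powr a"
    using assms by (intro powr_mono2) auto
  also have "\<dots> = (a / t) powr a * exp (t * m)"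
    using assms by (subst powr_mult) (simp add: exp_powr_real)
  finally show ?thesis
    by (simp add: exp_minus field_simps)
qed

text \<open>For \<open>t < 0\<close>, or \<open>t = 0\<close> and \<open>a > 0\<close>, the function is unbounded and \<open>decay a t\<close> is a junk value.\<close>

definition decay :: "real \<Rightarrow> real \<Rightarrow> cbdd" where
  "decay a t = Bcontfun (\<lambda>s. max 1 s powr a * exp (- (t * max 1 s)))"

text \<open>Boundedness is the point: for \<open>a > 0\<close> it is the smoothing estimate,
  otherwise both factors are at most 1.\<close>

lemma apply_decay:
  assumes "0 < t \<or> a \<le> 0 \<and> 0 \<le> t"
  shows "apply_bcontfun (decay a t) s = max 1 s powr a * exp (- (t * max 1 s))"
proof -
  have "\<exists>b. \<forall>s. norm (max 1 s powr a * exp (- (t * max 1 s))) \<le> b"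
  proof (cases "0 < a")
    case True
    then show ?thesis
      using assms by (auto intro!: exI[of _ "(a / t) powr a"] powr_mult_exp_le)
  next
    case False
    have "max 1 s powr a * exp (- (t * max 1 s)) \<le> 1" for s
    proof (rule mult_le_one)
      have "max 1 s powr a \<le> max 1 s powr 0"
        using False by (intro powr_mono) auto
      then show "max 1 s powr a \<le> 1"
        by (simp split: if_splits)
    qed (use assms in auto)
    then show ?thesis
      by (intro exI[of _ 1]) (simp add: abs_mult)
  qed
  then obtain b where b: "\<And>s. norm (max 1 s powr a * exp (- (t * max 1 s))) \<le> b"
    by blast
  have "(\<lambda>s. max 1 s powr a * exp (- (t * max 1 s))) \<in> bcontfun"
    by (rule bcontfun_normI[OF _ b]) (auto intro!: continuous_intros)
  then show ?thesis
    by (simp add: decay_def Bcontfun_inverse)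
qed

lemma norm_decay_le:
  assumes "0 < a" "0 < t"
  shows "norm (decay a t) \<le> (a / t) powr a"
  using assms by (intro norm_bound) (simp add: apply_decay abs_mult powr_mult_exp_le)

text \<open>A difference in time costs one more power of \<open>m\<close>, which the smoothing
  estimate with exponent \<open>a + 1\<close> absorbs uniformly in \<open>m\<close>. Hence
  \<open>decay a\<close> is Lipschitz on every \<open>{c..}\<close> with
  \<open>c > 0\<close>.\<close>

lemma continuous_on_decay:
  assumes a: "0 \<le> a"
  shows "continuous_on {0<..} (decay a)"
proof -
  have "isCont (decay a) t" if t: "0 < t" for t
  proof -
    define c where "c = t / 2"
    define L where "L = ((a + 1) / c) powr (a + 1)"
    have c: "0 < c" "c < t"
      using t by (auto simp: c_def)
    have incr: "dist (decay a x) (decay a y) \<le> L * (y - x)" if "c \<le> x" "x \<le> y" for x y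
    proof (rule dist_bound)
      fix s :: real
      define m where "m = max 1 s"
      have m: "1 \<le> m"
        by (simp add: m_def)
      have "m powr a * exp (- (x * m)) - m powr a * exp (- (y * m)) =
          m powr a * exp (- (x * m)) * (1 - exp (- ((y - x) * m)))"
        by (simp add: algebra_simps flip: exp_add)
      also have "\<dots> \<le> m powr a * exp (- (x * m)) * ((y - x) * m)"
        using exp_ge_add_one_self[of "- ((y - x) * m)"] by (intro mult_left_mono) auto
      also have "\<dots> = m powr (a + 1) * exp (- (x * m)) * (y - x)"
        using m by (simp add: powr_add)
      also have "\<dots> \<le> L * (y - x)"
      proof (rule mult_right_mono)
        have "m powr (a + 1) * exp (- (x * m)) \<le> ((a + 1) / x) powr (a + 1)"
          using a c m that by (intro powr_mult_exp_le) auto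
        also have "\<dots> \<le> L"
          unfolding L_def using a c that by (intro powr_mono2 divide_left_mono) auto
        finally show "m powr (a + 1) * exp (- (x * m)) \<le> L" .
      qed (use that in simp)
      finally have "m powr a * exp (- (x * m)) - m powr a * exp (- (y * m)) \<le> L * (y - x)" .
      moreover have "m powr a * exp (- (y * m)) \<le> m powr a * exp (- (x * m))"
        using that m by (intro mult_left_mono) (auto intro: mult_right_mono)
      ultimately show "dist (apply_bcontfun (decay a x) s) (apply_bcontfun (decay a y) s) \<le> L * (y - x)"
        using that c by (simp add: apply_decay dist_real_def m_def)
    qed
    have "L-lipschitz_on {c..} (decay a)"
    proof (rule lipschitz_onI)
      show "dist (decay a x) (decay a y) \<le> L * dist x y" if "x \<in> {c..}" "y \<in> {c..}" for x y
        using incr[of x y] incr[of y x] that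
        by (cases "x \<le> y") (auto simp: dist_real_def dist_commute)
    qed (simp add: L_def)
    then have "continuous_on {c..} (decay a)"
      by (rule lipschitz_on_continuous_on)
    then show ?thesis
      using c by (intro continuous_on_interior) auto
  qed
  then show ?thesis
    by (simp add: continuous_at_imp_continuous_on)
qed

lemma has_real_derivative_powr_exp:
  fixes a m z :: real
  assumes "0 < m"
  shows "((\<lambda>z. m powr a * exp (- (z * m))) has_real_derivative - (m powr (a + 1) * exp (- (z * m)))) (at z)"
proof -
  have "((\<lambda>z. exp (- (z * m))) has_real_derivative exp (- (z * m)) * (- m)) (at z)"
    by (auto intro!: derivative_eq_intros)
  from DERIV_cmult[OF this, of "m powr a"] show ?thesis
    using assms by (simp add: powr_add mult_ac)
qed

text \<open>Pointwise, the time derivative has size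
  \<open>m powr (1 - \<theta>) * exp (- (z * m))\<close>, at most
  \<open>z powr (\<theta> - 1)\<close> for every \<open>m\<close>, and
  \<open>z powr \<theta> / \<theta>\<close> is a primitive of that bound.\<close>

lemma decay_increment_le:
  assumes \<theta>: "0 < \<theta>" "\<theta> < 1" and st: "0 \<le> s" "s \<le> t"
  shows "norm (decay (- \<theta>) t - decay (- \<theta>) s) \<le> 1 / \<theta> * (t powr \<theta> - s powr \<theta>)"
proof (rule norm_bound)
  fix x :: real
  define m where "m = max 1 x"
  have m: "1 \<le> m"
    by (simp add: m_def)
  let ?F = "\<lambda>z. z powr \<theta> / \<theta> + m powr (- \<theta>) * exp (- (z * m))"
  have "?F s \<le> ?F t"
  \<comment> \<open>Derivatives are taken only in the open interval because \<open>s = 0\<close> is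
    allowed, where the power has infinite slope.\<close>
  proof (rule DERIV_nonneg_imp_increasing_open[OF st(2)])
    fix z assume z: "s < z" "z < t"
    then have "0 < z"
      using st by simp
    have "(?F has_real_derivative (z powr (\<theta> - 1) - m powr (1 - \<theta>) * exp (- (z * m)))) (at z)"
      using DERIV_add[OF DERIV_cdivide[OF has_real_derivative_powr[OF \<open>0 < z\<close>, of \<theta>], of \<theta>]
          has_real_derivative_powr_exp[of m "- \<theta>" z]] \<theta> m
      by simp
    moreover have "m powr (1 - \<theta>) * exp (- (z * m)) \<le> z powr (\<theta> - 1)"
    proof -
      have "m powr (1 - \<theta>) * exp (- (z * m)) \<le> ((1 - \<theta>) / z) powr (1 - \<theta>)"
        using \<theta> m \<open>0 < z\<close> by (intro powr_mult_exp_le) auto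
      also have "\<dots> \<le> (1 / z) powr (1 - \<theta>)"
        using \<theta> \<open>0 < z\<close> by (intro powr_mono2 divide_right_mono) auto
      also have "\<dots> = z powr (\<theta> - 1)"
        using \<open>0 < z\<close> powr_minus[of z "1 - \<theta>"] by (simp add: powr_divide inverse_eq_divide)
      finally show ?thesis .
    qed
    then have "0 \<le> z powr (\<theta> - 1) - m powr (1 - \<theta>) * exp (- (z * m))"
      by simp
    ultimately show "\<exists>D. (?F has_real_derivative D) (at z) \<and> 0 \<le> D"
      by blast
  next
    show "continuous_on {s..t} ?F"
      using \<theta> st by (intro continuous_on_add continuous_on_divide continuous_on_powr'
          continuous_on_mult continuous_on_exp continuous_on_minus continuous_on_id continuous_on_const) auto
  qed
  then have "m powr (- \<theta>) * exp (- (s * m)) - m powr (- \<theta>) * exp (- (t * m)) \<le> 1 / \<theta> * (t powr \<theta> - s powr \<theta>)"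
    by (simp add: diff_divide_distrib)
  moreover have "m powr (- \<theta>) * exp (- (t * m)) \<le> m powr (- \<theta>) * exp (- (s * m))"
    using st m by (intro mult_left_mono) (auto intro: mult_right_mono)
  moreover have "apply_bcontfun (decay (- \<theta>) t - decay (- \<theta>) s) x =
      m powr (- \<theta>) * exp (- (t * m)) - m powr (- \<theta>) * exp (- (s * m))"
    using st \<theta> by (simp add: apply_decay m_def)
  ultimately show "norm (apply_bcontfun (decay (- \<theta>) t - decay (- \<theta>) s) x) \<le> 1 / \<theta> * (t powr \<theta> - s powr \<theta>)"
    unfolding real_norm_def by linarith
qed

section \<open>The embedding of \<open>X1\<close> and the lower bound for the K-functional\<close>

definition damp :: "cbdd \<Rightarrow> cbdd" where
  "damp f = Bcontfun (\<lambda>s. apply_bcontfun f s / max 1 s)"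

lemma abs_apply_div_max_le: "\<bar>apply_bcontfun (f :: cbdd) s / max 1 s\<bar> \<le> norm f"
proof -
  have "\<bar>apply_bcontfun f s / max 1 s\<bar> \<le> \<bar>apply_bcontfun f s\<bar>"
    using mult_right_mono[of 1 "max 1 s" "\<bar>apply_bcontfun f s\<bar>"] by (simp add: field_simps)
  also have "\<dots> \<le> norm f"
    using norm_bounded[of f s] by simp
  finally show ?thesis .
qed

lemma apply_damp: "apply_bcontfun (damp f) s = apply_bcontfun f s / max 1 s"
proof -
  have "(\<lambda>s. apply_bcontfun f s / max 1 s) \<in> bcontfun"
    using abs_apply_div_max_le[of f] by (intro bcontfun_normI) (auto intro!: continuous_intros)
  then show ?thesis
    by (simp add: damp_def Bcontfun_inverse)
qed

lemma bounded_linear_damp: "bounded_linear damp"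
proof (rule bounded_linear_intro[where K = 1])
  show "norm (damp f) \<le> norm f * 1" for f
    using abs_apply_div_max_le[of f] by (simp add: norm_bound apply_damp)
qed (auto intro!: bcontfun_eqI simp: apply_damp add_divide_distrib)

lemma inj_damp: "inj damp"
proof (rule injI)
  fix f g assume eq: "damp f = damp g"
  show "f = g"
  proof (rule bcontfun_eqI)
    fix s
    have "apply_bcontfun f s / max 1 s = apply_bcontfun g s / max 1 s"
      using eq by (simp flip: apply_damp)
    moreover have "max 1 s \<noteq> 0"
      by linarith
    ultimately show "apply_bcontfun f s = apply_bcontfun g s"
      by simp
  qed
qed

text \<open>With \<open>a = 1 - \<theta>\<close> this turns the \<open>X1\<close>-valued function
  into the orbit in \<open>X0\<close>.\<close>

lemma damp_decay: "0 < t \<Longrightarrow> damp (decay a t) = decay (a - 1) t"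
  by (intro bcontfun_eqI) (simp add: apply_damp apply_decay powr_diff)

lemma continuous_embedding_bounded_linear:
  assumes "bounded_linear f" "inj f"
  shows "continuous_embedding UNIV euclidean f"
proof -
  interpret bounded_linear f by fact
  show ?thesis
    using assms continuous_on[of UNIV "\<lambda>x. x"]
    by (simp add: continuous_embedding_def add scaleR inj_on_def)
qed

lemma hausdorff_tvs_euclidean: "hausdorff_tvs (euclidean :: 'v::real_normed_vector topology)"
  unfolding hausdorff_tvs_def
  by (auto simp: case_prod_unfold euclidean_product_topology intro!: continuous_intros)

text \<open>Evaluate any splitting at the point \<open>1 / r\<close>: there \<open>damp\<close>
  multiplies by \<open>r\<close>, the left side equals \<open>r powr \<theta>\<close>, and point
  values are bounded by norms.\<close>

lemma K_functional_decay_ge: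
  assumes r: "0 < r" "r \<le> 1" and \<theta>: "0 < \<theta>"
  shows "r powr \<theta> \<le> K_functional UNIV id UNIV damp r (decay (- \<theta>) 0)"
  unfolding K_functional_def
proof (rule cInf_greatest)
  \<comment> \<open>The trivial splitting shows that the infimum is over a nonempty set and not a
    default value.\<close>
  have "norm (decay (- \<theta>) 0) + r * norm (0 :: cbdd) \<in>
      {norm x0 + r * norm x1 | x0 x1. x0 \<in> UNIV \<and> x1 \<in> UNIV \<and> decay (- \<theta>) 0 = id x0 + damp x1}"
    by (intro CollectI exI[of _ "decay (- \<theta>) 0"] exI[of _ "0 :: cbdd"])
      (simp add: bounded_linear_damp linear_0 bounded_linear.linear)
  then show "{norm x0 + r * norm x1 | x0 x1. x0 \<in> UNIV \<and> x1 \<in> UNIV \<and>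
      decay (- \<theta>) 0 = id x0 + damp x1} \<noteq> {}"
    by blast
next
  fix y assume "y \<in> {norm x0 + r * norm x1 | x0 x1. x0 \<in> UNIV \<and> x1 \<in> UNIV \<and>
      decay (- \<theta>) 0 = id x0 + damp x1}"
  then obtain x0 x1 where y: "y = norm x0 + r * norm x1" and eq: "decay (- \<theta>) 0 = x0 + damp x1"
    by auto
  have max: "max 1 (1 / r) = 1 / r"
    using r by (simp add: max_def field_simps)
  have "r powr \<theta> = apply_bcontfun (decay (- \<theta>) 0) (1 / r)"
    using r \<theta> by (simp add: apply_decay max powr_divide powr_minus inverse_eq_divide)
  also have "\<dots> = apply_bcontfun x0 (1 / r) + r * apply_bcontfun x1 (1 / r)"
    using r by (simp add: eq apply_damp max)
  also have "\<dots> \<le> norm x0 + r * norm x1"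
    using r norm_bounded[of x0 "1 / r"] norm_bounded[of x1 "1 / r"]
    by (intro add_mono mult_left_mono) auto
  finally show "r powr \<theta> \<le> y"
    by (simp add: y)
qed

section \<open>Distributional derivatives\<close>

lemma test_function_props:
  assumes "test_function T \<phi>"
  obtains C where "compact C" "C \<subseteq> {0<..<T}" "\<And>t. t \<notin> C \<Longrightarrow> \<phi> t = 0" "\<And>t. t \<notin> C \<Longrightarrow> deriv \<phi> t = 0"
    "continuous_on UNIV \<phi>" "continuous_on UNIV (deriv \<phi>)"
    "\<And>t. (\<phi> has_real_derivative deriv \<phi> t) (at t)"
proof -
  have diff: "((deriv ^^ n) \<phi>) field_differentiable (at t)" for n t
    using assms by (simp add: test_function_def)
  have diff0: "\<phi> field_differentiable (at t)" and diff1: "deriv \<phi> field_differentiable (at t)" for t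
    using diff[of 0 t] diff[of 1 t] by simp_all
  obtain C where C: "compact C" "C \<subseteq> {0<..<T}" "\<And>t. t \<notin> C \<Longrightarrow> \<phi> t = 0"
    using assms by (auto simp: test_function_def)
  \<comment> \<open>Since \<open>C\<close> is closed, \<phi> vanishes on a whole neighbourhood of
    \<open>t\<close>.\<close>
  have "deriv \<phi> t = 0" if "t \<notin> C" for t
  proof (rule DERIV_imp_deriv)
    show "(\<phi> has_real_derivative 0) (at t)"
      using compact_imp_closed[OF C(1)] C(3) that
      by (intro has_field_derivative_transform_within_open[OF DERIV_const[of 0], of "- C"]) auto
  qed
  then show ?thesis
    using that[OF C] diff0 diff1
    by (simp add: continuous_at_imp_continuous_on field_differentiable_imp_continuous_at
        field_differentiable_derivI)
qed

lemma bounded_linear_apply_bcontfun: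
  "bounded_linear (\<lambda>f :: 'a::topological_space \<Rightarrow>\<^sub>C 'b::real_normed_vector. apply_bcontfun f s)"
  by (rule bounded_linear_intro[where K = 1]) (auto simp: norm_bounded)

text \<open>Evaluations at points separate bounded continuous functions and commute with the
  integral. So the vector identity reduces, for each \<open>s\<close>, to the product rule and the
  fundamental theorem of calculus.\<close>

lemma distributional_derivative_pointwise:
  fixes f v :: "real \<Rightarrow> real \<Rightarrow>\<^sub>C 'b::banach"
  assumes T: "0 < T"
    and f: "continuous_on {0<..} f" and v: "continuous_on {0<..} v"
    and deriv: "\<And>s t. 0 < t \<Longrightarrow> ((\<lambda>t. apply_bcontfun (f t) s) has_vector_derivative apply_bcontfun (v t) s) (at t)"
  shows "distributional_derivative T f v"
  unfolding distributional_derivative_def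
proof (intro allI impI)
  fix \<phi> assume "test_function T \<phi>"
  then obtain C where C: "compact C" "C \<subseteq> {0<..<T}" "\<And>t. t \<notin> C \<Longrightarrow> \<phi> t = 0"
      "\<And>t. t \<notin> C \<Longrightarrow> deriv \<phi> t = 0"
    and \<phi>: "continuous_on UNIV \<phi>" "continuous_on UNIV (deriv \<phi>)"
      "\<And>t. (\<phi> has_real_derivative deriv \<phi> t) (at t)"
    by (rule test_function_props) (rule that)
  have C': "closed C" "C \<subseteq> {0<..}"
    using C(1,2) by (auto simp: compact_imp_closed)
  let ?g = "\<lambda>t. deriv \<phi> t *\<^sub>R f t" and ?h = "\<lambda>t. \<phi> t *\<^sub>R v t"
  have g: "continuous_on UNIV ?g" and h: "continuous_on UNIV ?h"
    using C C' \<phi> f v by (auto intro!: continuous_cutoff[where C = C])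
  have int: "F integrable_on {0..T}" if "continuous_on UNIV F" for F :: "real \<Rightarrow> real \<Rightarrow>\<^sub>C 'b"
    by (intro integrable_continuous_interval continuous_on_subset[OF that]) simp
  have "integral {0..T} ?g = - integral {0..T} ?h"
  proof (rule bcontfun_eqI)
    fix s
    let ?P = "\<lambda>t. \<phi> t *\<^sub>R apply_bcontfun (f t) s"
    have fs: "continuous_on {0<..} (\<lambda>t. apply_bcontfun (f t) s)"
      using deriv by (intro continuous_at_imp_continuous_on ballI has_vector_derivative_continuous) auto
    have "((\<lambda>t. apply_bcontfun (?g t + ?h t) s) has_integral (?P T - ?P 0)) {0..T}"
    proof (rule fundamental_theorem_of_calculus_interior)
      show "continuous_on {0..T} ?P"
        by (rule continuous_on_subset[OF continuous_cutoff[OF \<phi>(1) fs C' C(3)]]) auto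
      fix t assume "t \<in> {0<..<T}"
      then show "(?P has_vector_derivative apply_bcontfun (?g t + ?h t) s) (at t)"
        using has_vector_derivative_scaleR[OF \<phi>(3) deriv, of t s] by (simp add: add.commute)
    qed (use T in simp)
    moreover have "?P T = 0" "?P 0 = 0"
      \<comment> \<open>Both endpoints lie outside \<open>C\<close>, which is contained in the open
        interval.\<close>
      using C(2) by (auto intro!: C(3))
    moreover have "((\<lambda>t. apply_bcontfun (?g t + ?h t) s) has_integral
        apply_bcontfun (integral {0..T} ?g + integral {0..T} ?h) s) {0..T}"
      using has_integral_linear[OF has_integral_add[OF integrable_integral[OF int[OF g]]
          integrable_integral[OF int[OF h]]] bounded_linear_apply_bcontfun[of s]]
      by (simp add: o_def)
    ultimately have "apply_bcontfun (integral {0..T} ?g + integral {0..T} ?h) s = 0"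
      by (auto dest: has_integral_unique)
    then show "apply_bcontfun (integral {0..T} ?g) s = apply_bcontfun (- integral {0..T} ?h) s"
      by (simp add: eq_neg_iff_add_eq_0)
  qed
  then show "\<exists>x. has_bochner (lebesgue_on {0<..<T}) ?g x \<and> has_bochner (lebesgue_on {0<..<T}) ?h (- x)"
    using has_bochner_continuous[OF g T] has_bochner_continuous[OF h T]
    by (intro exI[of _ "integral {0..T} ?g"]) simp
qed

section \<open>Verification of the counterexample on the time interval \<open>(0, 1)\<close>\<close>

theorem proposition3p5:
  fixes lam p \<theta> q :: real
  assumes "0 < lam" "lam < 1" "1 < p"
    and "\<theta> = 1 - (1 - lam) / p"
    and "1 \<le> q"
  shows "\<exists>(V :: cbdd topology) (X0 :: cbdd set) (X1 :: cbdd set) j0 j1 i T u x.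
           banach_couple V X0 j0 X1 j1 \<and>
           continuous_embedding X1 (top_of_set X0) i \<and> (\<forall>y\<in>X1. j0 (i y) = j1 y) \<and>
           0 < T \<and>
           u \<in> evolution_class p lam T X0 X1 i \<and>
           has_initial_value T X0 i u x \<and>
           j0 x \<notin> real_interp \<theta> q X0 j0 X1 j1"
proof -
  have "(1 - lam) / p < 1"
    using assms by (simp add: field_simps)
  moreover have "0 < (1 - lam) / p"
    using assms by simp
  ultimately have \<theta>: "0 < \<theta>" "\<theta> < 1"
    using assms(4) by auto
  let ?u = "decay (1 - \<theta>)" and ?v = "\<lambda>t. - decay (1 - \<theta>) t" and ?w = "decay (- \<theta>)"
  have bound: "norm (?u t) \<le> t powr (- ((1 - lam) / p))" if t: "0 < t" for t
  proof -
    have "norm (?u t) \<le> ((1 - \<theta>) / t) powr (1 - \<theta>)"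
      using \<theta> t by (intro norm_decay_le) auto
    \<comment> \<open>Since \<open>1 - \<theta> < 1\<close>, the constant can be enlarged to 1, the
      one that \<open>morrey_powr_bound\<close> expects.\<close>
    also have "\<dots> \<le> (1 / t) powr (1 - \<theta>)"
      using \<theta> t by (intro powr_mono2 divide_right_mono) auto
    also have "\<dots> = t powr (- (1 - \<theta>))"
      unfolding powr_minus using t by (simp add: powr_divide inverse_eq_divide)
    finally show ?thesis
      using assms(4) by simp
  qed
  have u: "continuous_on {0<..} ?u"
    using \<theta> by (intro continuous_on_decay) simp
  have morrey: "?u \<in> morrey p lam 1 UNIV" "?v \<in> morrey p lam 1 UNIV"
    using bound assms u
    by (auto intro!: morrey_powr_bound strongly_measurable_continuous continuous_intros)
  have w: "damp (?u t) = ?w t" if "0 < t" for t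
    using damp_decay[OF that, of "1 - \<theta>"] by simp
  have "distributional_derivative 1 (\<lambda>t. damp (?u t)) ?v"
  proof (rule distributional_derivative_pointwise)
    show "continuous_on {0<..} (\<lambda>t. damp (?u t))"
      using bounded_linear.continuous_on[OF bounded_linear_damp u] .
    fix s t :: real assume t: "0 < t"
    have "((\<lambda>t. max 1 s powr (- \<theta>) * exp (- (t * max 1 s))) has_real_derivative
        apply_bcontfun (?v t) s) (at t)"
      using has_real_derivative_powr_exp[of "max 1 s" "- \<theta>" t] t by (simp add: apply_decay)
    then have "((\<lambda>t. max 1 s powr (- \<theta>) * exp (- (t * max 1 s))) has_vector_derivative
        apply_bcontfun (?v t) s) (at t)"
      by (simp add: has_real_derivative_iff_has_vector_derivative)
    then show "((\<lambda>t. apply_bcontfun (damp (?u t)) s) has_vector_derivative apply_bcontfun (?v t) s) (at t)"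
      \<comment> \<open>The identity \<open>w\<close> and the explicit formula agree on the open
        half-line, which suffices for the derivative at \<open>t > 0\<close>.\<close>
      by (rule has_vector_derivative_transform_within_open[of _ _ _ "{0<..}"])
        (use t in \<open>auto simp: w apply_decay\<close>)
  qed (use u in \<open>auto intro!: continuous_intros\<close>)
  then have "?u \<in> evolution_class p lam 1 UNIV UNIV damp"
    using morrey by (auto simp: evolution_class_def)
  moreover have "abs_continuous_on_interval 0 1 ?w"
    using \<theta> decay_increment_le[OF \<theta>]
    by (intro abs_continuous_on_interval_powr_bound[where \<theta> = \<theta> and c = "1 / \<theta>"]) auto
  then have "has_initial_value 1 UNIV damp ?u (?w 0)"
    unfolding has_initial_value_def
    by (intro exI[of _ ?w] conjI AE_I2) (auto simp: w space_restrict_space)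
  moreover have "id (?w 0) \<notin> real_interp \<theta> q UNIV id UNIV damp"
    using K_functional_decay_ge[OF _ _ \<theta>(1)] assms(5) by (intro not_in_real_interp) auto
  \<comment> \<open>The ambient space is \<open>X0\<close> itself, so \<open>j0\<close> is the
    identity and \<open>j1\<close> coincides with \<open>i\<close>.\<close>
  moreover have "banach_couple euclidean UNIV (id :: cbdd \<Rightarrow> cbdd) UNIV damp"
    by (simp add: banach_couple_def banach_subspace_def hausdorff_tvs_euclidean
        continuous_embedding_bounded_linear bounded_linear_damp inj_damp bounded_linear_ident id_def)
  moreover have "continuous_embedding UNIV (top_of_set UNIV) damp"
    by (simp add: continuous_embedding_bounded_linear bounded_linear_damp inj_damp)
  ultimately show ?thesis
    by (intro exI[of _ euclidean] exI[of _ UNIV] exI[of _ id] exI[of _ damp] exI[of _ 1]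
        exI[of _ ?u] exI[of _ "?w 0"]) auto
qed

end
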